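(* Let $|q|<1$, $x\in\mathbb{C}$, and $k\ge 1$ an integer. Then \[ \frac{1}{(q^2;q^2)_\infty} \sum_{n\geq 0} q^{(2k+1)n^2} \big(V_n(x)+V_{n-1}(x)\big) =\sum_{n_k\geq n_{k-1}\geq \cdots \geq n_1\geq 0} \frac{q^{2(n_1^2+\cdots +n_k^2)}\prod_{j=1}^{n_1} (1+2xq^{2j-1}+q^{4j-2})}{(q^2;q^2)_{n_k-n_{k-1}}(q^2;q^2)_{n_{k-1}-n_{k-2}}\cdots (q^2;q^2)_{n_2-n_1}(q^2;q^2)_{2n_1}}. \]
   Context: $(a;q)_n=\prod_{i=0}^{n-1}(1-aq^i)$, $(a;q)_\infty=\prod_{i\ge0}(1-aq^i)$. $V_n(x)$ is the Chebyshev polynomial of the third kind: $V_0=1$, $V_1=2x-1$, $V_n=2xV_{n-1}-V_{n-2}$ ($n>1$), and $V_n=0$ for $n<0$. For $k=1$ the sum is over $n_1\ge0$ only, with denominator $(q^2;q^2)_{2n_1}$. *)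

theory Defs
  imports "HOL-Analysis.Analysis"
begin

definition qpoch :: "complex \<Rightarrow> complex \<Rightarrow> nat \<Rightarrow> complex" where
  "qpoch a q n = (\<Prod>i<n. 1 - a * q ^ i)"

definition qpoch_inf :: "complex \<Rightarrow> complex \<Rightarrow> complex" where
  "qpoch_inf a q = (\<Prod>i. 1 - a * q ^ i)"

fun cheb_V_nat :: "nat \<Rightarrow> complex \<Rightarrow> complex" where
  "cheb_V_nat 0 x = 1"
| "cheb_V_nat (Suc 0) x = 2 * x - 1"
| "cheb_V_nat (Suc (Suc n)) x = 2 * x * cheb_V_nat (Suc n) x - cheb_V_nat n x"

definition cheb_V :: "int \<Rightarrow> complex \<Rightarrow> complex" where
  "cheb_V n x = (if n < 0 then 0 else cheb_V_nat (nat n) x)"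

text \<open>A multi-index \<open>n\<^sub>k \<ge> \<dots> \<ge> n\<^sub>1 \<ge> 0\<close> is a function on \<open>{1..k}\<close>; the extensional function space
  makes each tuple occur exactly once.\<close>

definition multi_indices :: "nat \<Rightarrow> (nat \<Rightarrow> nat) set" where
  "multi_indices k = {n \<in> {1..k} \<rightarrow>\<^sub>E UNIV. \<forall>j\<in>{1..<k}. n j \<le> n (j + 1)}"

definition multisum_term :: "nat \<Rightarrow> complex \<Rightarrow> complex \<Rightarrow> (nat \<Rightarrow> nat) \<Rightarrow> complex" where
  "multisum_term k q x n =
     q ^ (2 * (\<Sum>j=1..k. (n j)\<^sup>2)) *
     (\<Prod>j=1..n 1. 1 + 2 * x * q ^ (2 * j - 1) + q ^ (4 * j - 2)) /
     ((\<Prod>j=1..<k. qpoch (q\<^sup>2) (q\<^sup>2) (n (j + 1) - n j)) * qpoch (q\<^sup>2) (q\<^sup>2) (2 * n 1))"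

end

theory Submission imports Defs begin

text \<open>
  Choose \<open>z\<close> with \<open>2x = z + 1/z\<close>. Then \<open>V\<^sub>r(x) + V\<^sub>r\<^sub>-\<^sub>1(x) = z\<^sup>r + z\<^sup>-\<^sup>r\<close> for \<open>r \<ge> 1\<close>, so the
  finite Jacobi triple product says that \<open>\<alpha>\<^sub>r = q^(r\<^sup>2) (V\<^sub>r(x) + V\<^sub>r\<^sub>-\<^sub>1(x))\<close> and
  \<open>\<beta>\<^sub>n = (\<Prod>j=1..n. 1 + 2xq^(2j-1) + q^(4j-2)) / (Q;Q)\<^sub>2\<^sub>n\<close> form a Bailey pair for the base \<open>Q = q\<^sup>2\<close>.
  The \<open>q\<close>-Vandermonde sum turns a Bailey pair \<open>(\<alpha>, \<beta>)\<close> into a new one with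
  \<open>\<alpha>'\<^sub>r = Q^(r\<^sup>2) \<alpha>\<^sub>r\<close> and \<open>\<beta>'\<^sub>n = \<Sum>\<^sub>s Q^(s\<^sup>2) \<beta>\<^sub>s / (Q;Q)\<^sub>n\<^sub>-\<^sub>s\<close>, and \<open>k - 1\<close> such steps
  produce the inner sums over \<open>n\<^sub>1, \<dots>, n\<^sub>k\<^sub>-\<^sub>1\<close>. After one more step both expressions for \<open>\<beta>\<^sub>N\<close>
  converge as \<open>N \<rightarrow> \<infinity>\<close> by Tannery's theorem; cancelling a factor \<open>1 / (Q;Q)\<^sub>\<infinity>\<close> from the two limits
  leaves the identity.
\<close>

subsection \<open>\<open>q\<close>-Pochhammer symbols\<close>

lemma qpoch_0 [simp]: "qpoch a q 0 = 1"
  by (simp add: qpoch_def)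

lemma qpoch_Suc: "qpoch a q (Suc n) = qpoch a q n * (1 - a * q ^ n)"
  by (simp add: qpoch_def)

lemma qpoch_nonzero:
  assumes "norm a < 1" and "norm q \<le> 1"
  shows "qpoch a q n \<noteq> 0"
proof -
  have "norm (a * q ^ i) < 1" for i
    using assms mult_left_le[of "norm q ^ i" "norm a"]
    by (simp add: norm_mult norm_power power_le_one)
  then have "a * q ^ i \<noteq> 1" for i
    by (metis norm_one less_irrefl)
  then show ?thesis
    by (simp add: qpoch_def)
qed

lemma convergent_prod_one_minus_geometric:
  fixes a q :: "'a :: {real_normed_field, banach}"
  assumes "norm q < 1"
  shows "convergent_prod (\<lambda>i. 1 - a * q ^ i)"
proof -
  have "summable (\<lambda>i. norm a * norm q ^ i)"
    using assms by (intro summable_mult summable_geometric) auto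
  then show ?thesis
    by (intro abs_convergent_prod_imp_convergent_prod summable_imp_abs_convergent_prod)
       (simp add: norm_mult norm_power)
qed

lemma qpoch_tendsto:
  assumes "norm q < 1"
  shows "qpoch a q \<longlonglongrightarrow> qpoch_inf a q"
proof (rule LIMSEQ_imp_Suc)
  show "(\<lambda>n. qpoch a q (Suc n)) \<longlonglongrightarrow> qpoch_inf a q"
    using convergent_prod_LIMSEQ[OF convergent_prod_one_minus_geometric[OF assms]]
    by (simp add: qpoch_def qpoch_inf_def lessThan_Suc_atMost)
qed

lemma qpoch_diff_tendsto:
  assumes "norm q < 1"
  shows "(\<lambda>n. qpoch a q (n - r)) \<longlonglongrightarrow> qpoch_inf a q"
  by (rule LIMSEQ_offset[where k = r]) (simp add: qpoch_tendsto[OF assms])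

lemma qpoch_inf_nonzero:
  assumes "norm a < 1" and "norm q < 1"
  shows "qpoch_inf a q \<noteq> 0"
  unfolding qpoch_inf_def
proof (rule prodinf_nonzero)
  show "1 - a * q ^ i \<noteq> 0" for i
    using qpoch_nonzero[of a q "Suc i"] assms by (simp add: qpoch_Suc)
qed (rule convergent_prod_one_minus_geometric[OF assms(2)])

lemma inverse_qpoch_bounded:
  assumes "norm a < 1" and "norm q < 1"
  obtains C where "C > 0" "\<And>n. norm (inverse (qpoch a q n)) \<le> C"
proof -
  have "(\<lambda>n. inverse (qpoch a q n)) \<longlonglongrightarrow> inverse (qpoch_inf a q)"
    using assms by (intro tendsto_inverse qpoch_tendsto qpoch_inf_nonzero)
  then have "Bseq (\<lambda>n. inverse (qpoch a q n))"
    by (intro convergent_imp_Bseq convergentI)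
  then show ?thesis
    using that by (auto simp: Bseq_def)
qed

subsection \<open>\<open>q\<close>-binomial coefficients\<close>

(* The Pascal recursion makes sense for every q, whereas a quotient of q-factorials is junk at
   roots of unity. *)
fun qbinom :: "'a :: comm_semiring_1 \<Rightarrow> nat \<Rightarrow> nat \<Rightarrow> 'a" where
  "qbinom q n 0 = 1"
| "qbinom q 0 (Suc k) = 0"
| "qbinom q (Suc n) (Suc k) = qbinom q n k + q ^ Suc k * qbinom q n (Suc k)"

lemma qbinom_eq_0: "n < k \<Longrightarrow> qbinom q n k = 0"
  by (induction q n k rule: qbinom.induct) auto

lemma qbinom_self [simp]: "qbinom q n n = 1"
  by (induction n) (simp_all add: qbinom_eq_0)

lemma qbinom_Suc_Suc':
  "qbinom q (Suc n) (Suc k) = q ^ (n - k) * qbinom q n k + qbinom q n (Suc k)"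
proof (induction n arbitrary: k)
  case 0
  show ?case by (cases k) auto
next
  case (Suc n)
  consider (zero) "k = 0" | (inner) l where "k = Suc l" "k \<le> n" | (outer) "k > n"
    by (metis not_less not0_implies_Suc)
  then show ?case
  proof cases
    case zero
    then show ?thesis
      using Suc.IH[of 0] by (simp add: distrib_left) (metis add.left_commute)
  next
    case (inner l)
    have "qbinom q (Suc (Suc n)) (Suc k)
        = (q ^ (n - l) * qbinom q n l + qbinom q n k)
          + q ^ Suc k * (q ^ (n - k) * qbinom q n k + qbinom q n (Suc k))"
      by (simp only: qbinom.simps(3)[of q "Suc n"] Suc.IH inner)
    also have "q ^ Suc k * (q ^ (n - k) * qbinom q n k + qbinom q n (Suc k))
        = q ^ (n - l) * (q ^ k * qbinom q n k) + q ^ Suc k * qbinom q n (Suc k)"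
    proof -
      have "q ^ Suc k * q ^ (n - k) = q ^ (n - l) * q ^ k"
        using inner by (simp flip: power_add power_Suc)
      then show ?thesis
        by (simp only: distrib_left mult.assoc[symmetric])
    qed
    finally show ?thesis
      by (simp add: inner algebra_simps)
  next
    case outer
    then show ?thesis
      by (cases "k = Suc n") (simp_all add: qbinom_eq_0)
  qed
qed

lemma sum_qbinom_Suc:
  "(\<Sum>k\<le>Suc n. qbinom q (Suc n) k * f k) = (\<Sum>k\<le>n. qbinom q n k * (q ^ k * f k + f (Suc k)))"
proof -
  have "(\<Sum>k\<le>Suc n. qbinom q (Suc n) k * f k)
      = (\<Sum>k\<le>Suc n. qbinom q n k * (q ^ k * f k)) + (\<Sum>k\<le>n. qbinom q n k * f (Suc k))"
    unfolding sum.atMost_Suc_shift by (simp add: algebra_simps sum.distrib del: sum.atMost_Suc)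
  then show ?thesis
    by (simp add: qbinom_eq_0 distrib_left sum.distrib)
qed

lemma sum_qbinom_Suc':
  "(\<Sum>k\<le>Suc n. qbinom q (Suc n) k * f k) = (\<Sum>k\<le>n. qbinom q n k * (f k + q ^ (n - k) * f (Suc k)))"
proof -
  have "(\<Sum>k\<le>Suc n. qbinom q (Suc n) k * f k)
      = (\<Sum>k\<le>Suc n. qbinom q n k * f k) + (\<Sum>k\<le>n. qbinom q n k * (q ^ (n - k) * f (Suc k)))"
    unfolding sum.atMost_Suc_shift
    by (simp add: qbinom_Suc_Suc' algebra_simps sum.distrib del: sum.atMost_Suc qbinom.simps(3))
  then show ?thesis
    by (simp add: qbinom_eq_0 distrib_left sum.distrib)
qed

lemma q_binomial_theorem:
  fixes q z :: "'a :: comm_semiring_1"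
  shows "(\<Prod>j<m. z + q ^ (2 * j + 1)) = (\<Sum>k\<le>m. qbinom (q\<^sup>2) m k * (q ^ (m - k)\<^sup>2 * z ^ k))"
proof (induction m)
  case (Suc m)
  have "(q\<^sup>2) ^ k * (q ^ (Suc m - k)\<^sup>2 * z ^ k) + q ^ (Suc m - Suc k)\<^sup>2 * z ^ Suc k
      = (q ^ (m - k)\<^sup>2 * z ^ k) * (z + q ^ (2 * m + 1))" if "k \<le> m" for k
  proof -
    have "2 * k + (Suc m - k)\<^sup>2 = 2 * m + 1 + (m - k)\<^sup>2"
      using that by (auto simp: le_iff_add power2_eq_square)
    then have pow: "(q\<^sup>2) ^ k * q ^ (Suc m - k)\<^sup>2 = q ^ (2 * m + 1) * q ^ (m - k)\<^sup>2"
      by (simp only: flip: power_mult power_add)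
    show ?thesis
      unfolding mult.assoc[symmetric] pow by (simp add: algebra_simps)
  qed
  then have "(\<Sum>k\<le>Suc m. qbinom (q\<^sup>2) (Suc m) k * (q ^ (Suc m - k)\<^sup>2 * z ^ k))
      = (\<Sum>k\<le>m. qbinom (q\<^sup>2) m k * (q ^ (m - k)\<^sup>2 * z ^ k)) * (z + q ^ (2 * m + 1))"
    unfolding sum_qbinom_Suc sum_distrib_right mult.assoc by (intro sum.cong refl) simp
  then show ?case
    by (simp flip: Suc)
qed simp

lemma finite_triple_product:
  fixes q z :: "'a :: comm_semiring_1"
  shows "(\<Prod>j<m. z + q ^ (2 * j + 1)) * (\<Prod>j<n. 1 + z * q ^ (2 * j + 1))
    = (\<Sum>k\<le>m + n. qbinom (q\<^sup>2) (m + n) k * (q ^ nat ((int k - int m)\<^sup>2) * z ^ k))"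
proof (induction n)
  case 0
  have "nat ((int k - int m)\<^sup>2) = (m - k)\<^sup>2" if "k \<le> m" for k
    using that by (simp add: nat_eq_iff power2_commute)
  then show ?case
    using q_binomial_theorem[of z q m] by simp
next
  case (Suc n)
  define e where "e k = nat ((int k - int m)\<^sup>2)" for k
  have "q ^ e k * z ^ k + (q\<^sup>2) ^ (m + n - k) * (q ^ e (Suc k) * z ^ Suc k)
      = (q ^ e k * z ^ k) * (1 + z * q ^ (2 * n + 1))" if "k \<le> m + n" for k
  proof -
    have "int (2 * (m + n - k) + e (Suc k)) = int (2 * n + 1 + e k)"
      using that unfolding e_def by simp algebra
    then have "2 * (m + n - k) + e (Suc k) = 2 * n + 1 + e k"
      by linarith
    then have pow: "(q\<^sup>2) ^ (m + n - k) * q ^ e (Suc k) = q ^ (2 * n + 1) * q ^ e k"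
      by (simp only: flip: power_mult power_add)
    show ?thesis
      unfolding mult.assoc[symmetric] pow by (simp add: algebra_simps)
  qed
  then have "(\<Sum>k\<le>m + Suc n. qbinom (q\<^sup>2) (m + Suc n) k * (q ^ e k * z ^ k))
      = (\<Sum>k\<le>m + n. qbinom (q\<^sup>2) (m + n) k * (q ^ e k * z ^ k)) * (1 + z * q ^ (2 * n + 1))"
    unfolding add_Suc_right sum_qbinom_Suc' sum_distrib_right mult.assoc
    by (intro sum.cong refl) simp
  then show ?case
    unfolding e_def by (simp add: mult.assoc flip: Suc)
qed

lemma qbinom_mult_qpoch: "qbinom q (m + n) m * (qpoch q q m * qpoch q q n) = qpoch q q (m + n)"
proof (induction m arbitrary: n)
  case (Suc m)
  note outer_IH = Suc.IH
  show ?case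
  proof (induction n)
    case (Suc n)
    have "qbinom q (Suc m + Suc n) (Suc m) * (qpoch q q (Suc m) * qpoch q q (Suc n))
      = (1 - q ^ Suc m) * (qbinom q (m + Suc n) m * (qpoch q q m * qpoch q q (Suc n)))
        + q ^ Suc m * (1 - q ^ Suc n)
          * (qbinom q (Suc m + n) (Suc m) * (qpoch q q (Suc m) * qpoch q q n))"
      by (simp add: qpoch_Suc algebra_simps)
    also have "\<dots> = (1 - q ^ (Suc m + Suc n)) * qpoch q q (Suc m + n)"
      unfolding Suc.IH outer_IH by (simp add: algebra_simps power_add)
    finally show ?case
      by (simp add: qpoch_Suc)
  qed simp
qed simp

lemma qbinom_eq_qpoch:
  assumes "\<And>n. qpoch q q n \<noteq> 0" and "k \<le> n"
  shows "qbinom q n k = qpoch q q n / (qpoch q q k * qpoch q q (n - k))"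
  using qbinom_mult_qpoch[of q k "n - k"] assms by (simp add: field_simps)

lemma q_vandermonde:
  assumes nz: "\<And>n. qpoch q q n \<noteq> 0"
  shows "(\<Sum>j\<le>n. qbinom q n j * (q ^ (j * (j + m)) / qpoch q q (j + m))) = 1 / qpoch q q (n + m)"
proof (induction n arbitrary: m)
  case (Suc n)
  have "qbinom q n j * (q ^ (n - j) * (q ^ (Suc j * (Suc j + m)) / qpoch q q (Suc j + m)))
      = q ^ Suc (n + m) * (qbinom q n j * (q ^ (j * (j + Suc m)) / qpoch q q (j + Suc m)))"
    if "j \<le> n" for j
  proof -
    have "n - j + Suc j * (Suc j + m) = Suc (n + m) + j * (j + Suc m)"
      using that by simp
    then have pow: "q ^ (n - j) * q ^ (Suc j * (Suc j + m)) = q ^ Suc (n + m) * q ^ (j * (j + Suc m))"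
      by (simp only: flip: power_add)
    show ?thesis
      unfolding times_divide_eq_right pow by (simp add: mult_ac)
  qed
  then have "(\<Sum>j\<le>Suc n. qbinom q (Suc n) j * (q ^ (j * (j + m)) / qpoch q q (j + m)))
     = 1 / qpoch q q (n + m) + q ^ Suc (n + m) * (1 / qpoch q q (n + Suc m))"
    unfolding sum_qbinom_Suc' distrib_left sum.distrib Suc.IH[symmetric] sum_distrib_left
    by (intro arg_cong2[where f = "(+)"] sum.cong refl) auto
  also have "\<dots> = 1 / qpoch q q (Suc n + m)"
    using nz[of "Suc (n + m)"] by (simp add: qpoch_Suc divide_simps)
  finally show ?case .
qed simp

subsection \<open>Bailey pairs\<close>

definition bailey_kernel :: "complex \<Rightarrow> nat \<Rightarrow> nat \<Rightarrow> complex" where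
  "bailey_kernel q n r = 1 / (qpoch q q (n - r) * qpoch q q (n + r))"

definition bailey_pair :: "complex \<Rightarrow> (nat \<Rightarrow> complex) \<Rightarrow> (nat \<Rightarrow> complex) \<Rightarrow> bool" where
  "bailey_pair q \<alpha> \<beta> \<longleftrightarrow> (\<forall>n. \<beta> n = (\<Sum>r\<le>n. \<alpha> r * bailey_kernel q n r))"

definition bailey_step :: "complex \<Rightarrow> (nat \<Rightarrow> complex) \<Rightarrow> nat \<Rightarrow> complex" where
  "bailey_step q \<beta> n = (\<Sum>s\<le>n. q ^ s\<^sup>2 * \<beta> s / qpoch q q (n - s))"

lemma sum_bailey_kernel:
  assumes nz: "\<And>n. qpoch q q n \<noteq> 0" and "r \<le> n"
  shows "(\<Sum>s=r..n. q ^ s\<^sup>2 * bailey_kernel q s r / qpoch q q (n - s)) = q ^ r\<^sup>2 * bailey_kernel q n r"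
proof -
  have "(\<Sum>s=r..n. q ^ s\<^sup>2 * bailey_kernel q s r / qpoch q q (n - s))
      = (\<Sum>j\<le>n - r. q ^ (r + j)\<^sup>2 * bailey_kernel q (r + j) r / qpoch q q (n - (r + j)))"
    unfolding sum.atLeastAtMost_shift_0[OF \<open>r \<le> n\<close>] atMost_atLeast0 by simp
  also have "\<dots> = (\<Sum>j\<le>n - r. q ^ r\<^sup>2 / qpoch q q (n - r) *
      (qbinom q (n - r) j * (q ^ (j * (j + 2 * r)) / qpoch q q (j + 2 * r))))"
  proof (intro sum.cong refl)
    fix j assume "j \<in> {..n - r}"
    moreover have "q ^ (r + j)\<^sup>2 = q ^ r\<^sup>2 * q ^ (j * (j + 2 * r))"
      unfolding power_add[symmetric]
      by (rule arg_cong[of _ _ "power q"]) (simp add: power2_eq_square algebra_simps)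
    moreover have "bailey_kernel q (r + j) r = 1 / (qpoch q q j * qpoch q q (j + 2 * r))"
      by (simp add: bailey_kernel_def mult_2 add_ac)
    ultimately show "q ^ (r + j)\<^sup>2 * bailey_kernel q (r + j) r / qpoch q q (n - (r + j))
      = q ^ r\<^sup>2 / qpoch q q (n - r) *
        (qbinom q (n - r) j * (q ^ (j * (j + 2 * r)) / qpoch q q (j + 2 * r)))"
      using nz[of "n - r"] by (simp add: qbinom_eq_qpoch[OF nz])
  qed
  also have "\<dots> = q ^ r\<^sup>2 / qpoch q q (n - r) * (1 / qpoch q q (n - r + 2 * r))"
    by (simp only: q_vandermonde[OF nz] flip: sum_distrib_left)
  also have "n - r + 2 * r = n + r"
    using \<open>r \<le> n\<close> by simp
  finally show ?thesis
    by (simp add: bailey_kernel_def)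
qed

lemma bailey_pair_step:
  assumes nz: "\<And>n. qpoch q q n \<noteq> 0" and bp: "bailey_pair q \<alpha> \<beta>"
  shows "bailey_pair q (\<lambda>r. q ^ r\<^sup>2 * \<alpha> r) (bailey_step q \<beta>)"
  unfolding bailey_pair_def
proof
  fix n
  define t where "t r s = \<alpha> r * (q ^ s\<^sup>2 * bailey_kernel q s r / qpoch q q (n - s))" for r s
  have "bailey_step q \<beta> n = (\<Sum>s\<le>n. \<Sum>r\<in>{r \<in> {..n}. r \<le> s}. t r s)"
    unfolding bailey_step_def
  proof (intro sum.cong refl)
    fix s assume "s \<in> {..n}"
    then have "{r \<in> {..n}. r \<le> s} = {..s}"
      by auto
    then show "q ^ s\<^sup>2 * \<beta> s / qpoch q q (n - s) = (\<Sum>r\<in>{r \<in> {..n}. r \<le> s}. t r s)"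
      using bp by (simp add: bailey_pair_def t_def sum_distrib_left sum_divide_distrib mult_ac)
  qed
  also have "\<dots> = (\<Sum>r\<le>n. \<Sum>s\<in>{s \<in> {..n}. r \<le> s}. t r s)"
    by (rule sum.swap_restrict) auto
  also have "\<dots> = (\<Sum>r\<le>n. \<alpha> r * (\<Sum>s=r..n. q ^ s\<^sup>2 * bailey_kernel q s r / qpoch q q (n - s)))"
    unfolding t_def sum_distrib_left by (intro sum.cong) auto
  also have "\<dots> = (\<Sum>r\<le>n. q ^ r\<^sup>2 * \<alpha> r * bailey_kernel q n r)"
    by (intro sum.cong refl) (simp add: sum_bailey_kernel[OF nz])
  finally show "bailey_step q \<beta> n = \<dots>" .
qed

lemma bailey_pair_funpow_step:
  assumes "\<And>n. qpoch q q n \<noteq> 0" and "bailey_pair q \<alpha> \<beta>"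
  shows "bailey_pair q (\<lambda>r. q ^ (m * r\<^sup>2) * \<alpha> r) ((bailey_step q ^^ m) \<beta>)"
proof (induction m)
  case 0
  show ?case using assms(2) by simp
next
  case (Suc m)
  show ?case
    using bailey_pair_step[OF assms(1) Suc.IH] by (simp add: power_add mult.assoc)
qed

lemma tendsto_sum_atMost_dominated:
  fixes f :: "nat \<Rightarrow> nat \<Rightarrow> 'a :: {real_normed_algebra, banach}"
  assumes M: "summable M" and bound: "\<And>r n. r \<le> n \<Longrightarrow> norm (f r n) \<le> M r"
    and lim: "\<And>r. (\<lambda>n. f r n) \<longlonglongrightarrow> L r"
  shows "(\<lambda>n. \<Sum>r\<le>n. f r n) \<longlonglongrightarrow> (\<Sum>r. L r)"
proof -
  define g where "g r n = (if r \<le> n then f r n else 0)" for r n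
  have "(\<lambda>n. \<Sum>r. g r n) \<longlonglongrightarrow> (\<Sum>r. L r)"
  proof (rule tannerys_theorem[THEN conjunct2, THEN conjunct2])
    show "(\<lambda>n. g r n) \<longlonglongrightarrow> L r" for r
      using lim
    proof (rule Lim_transform_eventually)
      show "\<forall>\<^sub>F n in sequentially. f r n = g r n"
        using eventually_ge_at_top[of r] by eventually_elim (simp add: g_def)
    qed
    have "norm (g r n) \<le> M r" for r n
      using bound order_trans[OF norm_ge_zero bound[of r r]] by (simp add: g_def)
    then show "\<forall>\<^sub>F (r, n) in at_top \<times>\<^sub>F sequentially. norm (g r n) \<le> M r"
      by (simp add: case_prod_unfold)
  qed (use M in simp_all)
  moreover have "(\<Sum>r. g r n) = (\<Sum>r\<le>n. f r n)" for n
    by (subst suminf_finite[of "{..n}"]) (auto simp: g_def)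
  ultimately show ?thesis
    by simp
qed

lemma bailey_kernel_tendsto:
  assumes "norm q < 1"
  shows "(\<lambda>n. bailey_kernel q n r) \<longlonglongrightarrow> 1 / (qpoch_inf q q)\<^sup>2"
  unfolding bailey_kernel_def power2_eq_square using assms qpoch_inf_nonzero[of q q]
  by (intro tendsto_intros qpoch_diff_tendsto LIMSEQ_ignore_initial_segment qpoch_tendsto) auto

lemma bailey_pair_tendsto:
  assumes q: "norm q < 1" and bp: "bailey_pair q \<alpha> \<beta>" and \<alpha>: "summable (\<lambda>r. norm (\<alpha> r))"
  shows "\<beta> \<longlonglongrightarrow> (\<Sum>r. \<alpha> r) / (qpoch_inf q q)\<^sup>2"
proof -
  obtain C where C: "C > 0" "\<And>n. norm (inverse (qpoch q q n)) \<le> C"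
    using inverse_qpoch_bounded[OF q q] by blast
  have "(\<lambda>n. \<Sum>r\<le>n. \<alpha> r * bailey_kernel q n r) \<longlonglongrightarrow> (\<Sum>r. \<alpha> r * (1 / (qpoch_inf q q)\<^sup>2))"
  proof (rule tendsto_sum_atMost_dominated)
    show "summable (\<lambda>r. norm (\<alpha> r) * (C * C))"
      by (intro summable_mult2 \<alpha>)
    have "norm (bailey_kernel q n r) \<le> C * C" for n r
      unfolding bailey_kernel_def divide_inverse norm_mult inverse_mult_distrib
      using C by (auto simp: less_imp_le intro!: mult_mono)
    then show "norm (\<alpha> r * bailey_kernel q n r) \<le> norm (\<alpha> r) * (C * C)" for r n
      by (simp add: norm_mult mult_left_mono)
    show "(\<lambda>n. \<alpha> r * bailey_kernel q n r) \<longlonglongrightarrow> \<alpha> r * (1 / (qpoch_inf q q)\<^sup>2)" for r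
      by (intro tendsto_mult_left bailey_kernel_tendsto q)
  qed
  moreover have "(\<lambda>n. \<Sum>r\<le>n. \<alpha> r * bailey_kernel q n r) = \<beta>"
    using bp by (simp add: bailey_pair_def fun_eq_iff)
  ultimately show ?thesis
    using summable_norm_cancel[OF \<alpha>] by (simp add: suminf_divide)
qed

lemma bailey_step_tendsto:
  assumes q: "norm q < 1" and \<beta>: "summable (\<lambda>s. norm (q ^ s\<^sup>2 * \<beta> s))"
  shows "bailey_step q \<beta> \<longlonglongrightarrow> (\<Sum>s. q ^ s\<^sup>2 * \<beta> s) / qpoch_inf q q"
proof -
  obtain C where C: "C > 0" "\<And>n. norm (inverse (qpoch q q n)) \<le> C"
    using inverse_qpoch_bounded[OF q q] by blast
  have "(\<lambda>n. \<Sum>s\<le>n. q ^ s\<^sup>2 * \<beta> s / qpoch q q (n - s)) \<longlonglongrightarrow> (\<Sum>s. q ^ s\<^sup>2 * \<beta> s / qpoch_inf q q)"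
  proof (rule tendsto_sum_atMost_dominated)
    show "summable (\<lambda>s. norm (q ^ s\<^sup>2 * \<beta> s) * C)"
      by (intro summable_mult2 \<beta>)
    show "norm (q ^ s\<^sup>2 * \<beta> s / qpoch q q (n - s)) \<le> norm (q ^ s\<^sup>2 * \<beta> s) * C" for s n
      unfolding divide_inverse norm_mult[of _ "inverse _"] using C by (intro mult_left_mono) auto
    show "(\<lambda>n. q ^ s\<^sup>2 * \<beta> s / qpoch q q (n - s)) \<longlonglongrightarrow> q ^ s\<^sup>2 * \<beta> s / qpoch_inf q q" for s
      using qpoch_inf_nonzero[OF q q] by (intro tendsto_intros qpoch_diff_tendsto q) auto
  qed
  then show ?thesis
    using summable_norm_cancel[OF \<beta>] by (simp add: suminf_divide flip: bailey_step_def)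
qed

lemma summable_norm_power_mult:
  fixes q :: "'a :: real_normed_field" and \<alpha> :: "nat \<Rightarrow> 'a"
  assumes "norm q \<le> 1" and \<alpha>: "summable (\<lambda>r. norm (\<alpha> r))"
  shows "summable (\<lambda>r. norm (q ^ e r * \<alpha> r))"
proof (rule summable_comparison_test'[where N = 0, OF \<alpha>])
  show "norm (norm (q ^ e r * \<alpha> r)) \<le> norm (\<alpha> r)" for r
    using assms(1) by (simp add: norm_mult norm_power mult_left_le_one_le power_le_one)
qed

lemma summable_norm_power_square_mult_Bseq:
  fixes q :: "'a :: real_normed_field" and \<beta> :: "nat \<Rightarrow> 'a"
  assumes q: "norm q < 1" and "Bseq \<beta>"
  shows "summable (\<lambda>s. norm (q ^ s\<^sup>2 * \<beta> s))"
proof -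
  obtain K where K: "K > 0" "\<And>s. norm (\<beta> s) \<le> K"
    using \<open>Bseq \<beta>\<close> by (auto simp: Bseq_def)
  show ?thesis
  proof (rule summable_comparison_test'[where N = 0])
    show "summable (\<lambda>s. norm q ^ s * K)"
      using q by (intro summable_mult2 summable_geometric) simp
    show "norm (norm (q ^ s\<^sup>2 * \<beta> s)) \<le> norm q ^ s * K" for s
      using q K
      by (auto simp: norm_mult norm_power power2_eq_square intro!: mult_mono power_decreasing)
  qed
qed

lemma bailey_pair_imp_Bseq:
  assumes "norm q < 1" and "bailey_pair q \<alpha> \<beta>" and "summable (\<lambda>r. norm (\<alpha> r))"
  shows "Bseq \<beta>"
  using bailey_pair_tendsto[OF assms] by (intro convergent_imp_Bseq convergentI)

lemma bailey_lemma_suminf: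
  assumes q: "norm q < 1" and bp: "bailey_pair q \<alpha> \<beta>" and \<alpha>: "summable (\<lambda>r. norm (\<alpha> r))"
  shows "(\<Sum>s. q ^ s\<^sup>2 * \<beta> s) = 1 / qpoch_inf q q * (\<Sum>r. q ^ r\<^sup>2 * \<alpha> r)"
proof -
  have "bailey_step q \<beta> \<longlonglongrightarrow> (\<Sum>r. q ^ r\<^sup>2 * \<alpha> r) / (qpoch_inf q q)\<^sup>2"
    using bailey_pair_step[OF qpoch_nonzero bp] summable_norm_power_mult[OF _ \<alpha>] q
    by (intro bailey_pair_tendsto) auto
  moreover have "bailey_step q \<beta> \<longlonglongrightarrow> (\<Sum>s. q ^ s\<^sup>2 * \<beta> s) / qpoch_inf q q"
    using bailey_pair_imp_Bseq[OF assms]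
    by (intro bailey_step_tendsto summable_norm_power_square_mult_Bseq q)
  ultimately show ?thesis
    using LIMSEQ_unique qpoch_inf_nonzero[OF q q] by (fastforce simp: field_simps power2_eq_square)
qed

subsection \<open>The multisum of a Bailey chain\<close>

definition bailey_chain_term :: "nat \<Rightarrow> complex \<Rightarrow> (nat \<Rightarrow> complex) \<Rightarrow> (nat \<Rightarrow> nat) \<Rightarrow> complex" where
  "bailey_chain_term k q \<beta> n =
     q ^ (\<Sum>j=1..k. (n j)\<^sup>2) * \<beta> (n 1) / (\<Prod>j=1..<k. qpoch q q (n (j + 1) - n j))"

definition multi_indices_last :: "nat \<Rightarrow> nat \<Rightarrow> (nat \<Rightarrow> nat) set" where
  "multi_indices_last k N = {n \<in> multi_indices k. n k = N}"

lemma multi_indices_last_nth: "n \<in> multi_indices_last k N \<Longrightarrow> n k = N"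
  by (simp add: multi_indices_last_def)

lemma bij_betw_snd_multi_indices_last:
  "bij_betw snd (SIGMA N:UNIV. multi_indices_last k N) (multi_indices k)"
  by (rule bij_betw_byWitness[where f' = "\<lambda>n. (n k, n)"]) (auto simp: multi_indices_last_def)

lemma multi_indices_last_1: "multi_indices_last 1 N = {\<lambda>i\<in>{1}. N}"
  by (auto simp: multi_indices_last_def multi_indices_def PiE_iff extensional_def fun_eq_iff)

lemma bij_betw_multi_indices_last_Suc:
  assumes "k \<ge> 1"
  shows "bij_betw (\<lambda>(r, n). n(Suc k := N)) (SIGMA r:{..N}. multi_indices_last k r)
    (multi_indices_last (Suc k) N)"
proof (rule bij_betw_byWitness[where f' = "\<lambda>n. (n k, n(Suc k := undefined))"])
  have "n(Suc k := undefined) = n" if "n \<in> multi_indices k" for n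
    using that by (auto simp: multi_indices_def PiE_iff extensional_def)
  then show "\<forall>a\<in>SIGMA r:{..N}. multi_indices_last k r.
      (\<lambda>n. (n k, n(Suc k := undefined))) ((\<lambda>(r, n). n(Suc k := N)) a) = a"
    by (auto simp: multi_indices_last_def)
  have "n j \<le> (n(Suc k := N)) (Suc j)"
    if "n \<in> multi_indices k" "n k \<le> N" "1 \<le> j" "j \<le> k" for n j
    using that by (cases "j = k") (auto simp: multi_indices_def)
  then show "(\<lambda>(r, n). n(Suc k := N)) ` (SIGMA r:{..N}. multi_indices_last k r)
      \<subseteq> multi_indices_last (Suc k) N"
    by (auto simp: multi_indices_last_def multi_indices_def PiE_iff extensional_def)
  show "(\<lambda>n. (n k, n(Suc k := undefined))) ` multi_indices_last (Suc k) N
      \<subseteq> (SIGMA r:{..N}. multi_indices_last k r)"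
    using assms by (auto simp: multi_indices_last_def multi_indices_def PiE_iff extensional_def)
qed (auto simp: multi_indices_last_def)

lemma finite_multi_indices_last: "finite (multi_indices_last (Suc m) N)"
proof (induction m arbitrary: N)
  case 0
  show ?case
    using multi_indices_last_1 by simp
next
  case (Suc m)
  then show ?case
    using bij_betw_finite[OF bij_betw_multi_indices_last_Suc[of "Suc m" N]] by simp
qed

lemma bailey_chain_term_fun_upd:
  assumes "k \<ge> 1"
  shows "bailey_chain_term (Suc k) q \<beta> (n(Suc k := N))
    = q ^ N\<^sup>2 * (bailey_chain_term k q \<beta> n / qpoch q q (N - n k))"
proof -
  define n' where "n' = n(Suc k := N)"
  have "(\<Sum>j=1..k. (n' j)\<^sup>2) = (\<Sum>j=1..k. (n j)\<^sup>2)"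
    by (intro sum.cong) (auto simp: n'_def)
  moreover have "(\<Prod>j=1..<k. qpoch q q (n' (j + 1) - n' j)) = (\<Prod>j=1..<k. qpoch q q (n (j + 1) - n j))"
    by (intro prod.cong) (auto simp: n'_def)
  moreover have "n' 1 = n 1" "n' k = n k" "n' (Suc k) = N"
    using assms by (auto simp: n'_def)
  ultimately have "bailey_chain_term (Suc k) q \<beta> n'
      = q ^ N\<^sup>2 * (bailey_chain_term k q \<beta> n / qpoch q q (N - n k))"
    using assms by (simp add: bailey_chain_term_def prod.atLeastLessThan_Suc power_add)
  then show ?thesis
    by (simp add: n'_def)
qed

lemma sum_bailey_chain_term:
  "(\<Sum>n\<in>multi_indices_last (Suc m) N. bailey_chain_term (Suc m) q \<beta> n)
    = q ^ N\<^sup>2 * (bailey_step q ^^ m) \<beta> N"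
proof (induction m arbitrary: N)
  case 0
  show ?case
    using multi_indices_last_1 by (simp add: bailey_chain_term_def)
next
  case (Suc m)
  have "(\<Sum>n\<in>multi_indices_last (Suc (Suc m)) N. bailey_chain_term (Suc (Suc m)) q \<beta> n)
      = (\<Sum>(r, n)\<in>(SIGMA r:{..N}. multi_indices_last (Suc m) r).
           bailey_chain_term (Suc (Suc m)) q \<beta> (n(Suc (Suc m) := N)))"
    by (subst sum.reindex_bij_betw[OF bij_betw_multi_indices_last_Suc, symmetric])
       (simp_all add: case_prod_unfold)
  also have "\<dots> = (\<Sum>r\<le>N. \<Sum>n\<in>multi_indices_last (Suc m) r.
      q ^ N\<^sup>2 * (bailey_chain_term (Suc m) q \<beta> n / qpoch q q (N - r)))"
    by (subst sum.Sigma[symmetric])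
       (auto intro!: sum.cong
         simp: finite_multi_indices_last bailey_chain_term_fun_upd multi_indices_last_nth)
  also have "\<dots> = q ^ N\<^sup>2 * (\<Sum>r\<le>N. q ^ r\<^sup>2 * (bailey_step q ^^ m) \<beta> r / qpoch q q (N - r))"
    by (simp only: Suc.IH flip: sum_distrib_left sum_divide_distrib)
  also have "\<dots> = q ^ N\<^sup>2 * (bailey_step q ^^ Suc m) \<beta> N"
    by (simp add: bailey_step_def)
  finally show ?case .
qed

lemma bailey_chain_term_bound:
  assumes q: "norm q < 1" and "Bseq \<beta>"
  obtains D where "\<And>n. norm (bailey_chain_term k q \<beta> n) \<le> D * (\<Prod>j=1..k. norm q ^ n j)"
proof -
  obtain C where C: "C > 0" "\<And>n. norm (inverse (qpoch q q n)) \<le> C"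
    using inverse_qpoch_bounded[OF q q] by blast
  obtain K where K: "K > 0" "\<And>s. norm (\<beta> s) \<le> K"
    using \<open>Bseq \<beta>\<close> by (auto simp: Bseq_def)
  have "norm (bailey_chain_term k q \<beta> n) \<le> (\<Prod>j=1..k. norm q ^ n j) * K * (\<Prod>j=1..<k. C)" for n
  proof -
    have "norm (q ^ (\<Sum>j=1..k. (n j)\<^sup>2)) \<le> (\<Prod>j=1..k. norm q ^ n j)"
      unfolding power_sum prod_norm[symmetric] norm_power using q
      by (intro prod_mono conjI power_decreasing) (auto simp: power2_eq_square)
    moreover have "norm (inverse (\<Prod>j=1..<k. qpoch q q (n (j + 1) - n j))) \<le> (\<Prod>j=1..<k. C)"
      unfolding prod_inversef[symmetric, unfolded o_def] prod_norm[symmetric]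
      by (intro prod_mono) (auto simp: C)
    ultimately show ?thesis
      unfolding bailey_chain_term_def divide_inverse norm_mult using C K
      by (intro mult_mono mult_nonneg_nonneg prod_nonneg) (auto simp: less_imp_le)
  qed
  then show ?thesis
    using that[of "K * (\<Prod>j=1..<k. C)"] by (simp add: mult_ac)
qed

lemma bailey_chain_term_summable_on:
  assumes q: "norm q < 1" and "Bseq \<beta>"
  shows "bailey_chain_term k q \<beta> summable_on multi_indices k"
proof -
  obtain D where D: "\<And>n. norm (bailey_chain_term k q \<beta> n) \<le> D * (\<Prod>j=1..k. norm q ^ n j)"
    using bailey_chain_term_bound[OF assms] by blast
  have "Infinite_Set_Sum.abs_summable_on (\<lambda>n. \<Prod>j=1..k. norm q ^ n j) ({1..k} \<rightarrow>\<^sub>E UNIV)"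
    using q by (intro abs_summable_on_prod_PiE) (auto simp: abs_summable_on_nat_iff')
  then have "(\<lambda>n. \<Prod>j=1..k. norm q ^ n j) summable_on ({1..k} \<rightarrow>\<^sub>E UNIV)"
    by (rule abs_summable_summable[OF abs_summable_equivalent[THEN iffD2]])
  then have "(\<lambda>n. D * (\<Prod>j=1..k. norm q ^ n j)) summable_on ({1..k} \<rightarrow>\<^sub>E UNIV)"
    by (rule summable_on_cmult_right)
  then have "(\<lambda>n. D * (\<Prod>j=1..k. norm q ^ n j)) summable_on multi_indices k"
    by (rule summable_on_subset_banach) (auto simp: multi_indices_def)
  then have "(\<lambda>n. norm (bailey_chain_term k q \<beta> n)) summable_on multi_indices k"
    by (rule summable_on_comparison_test) (use D in auto)
  then show ?thesis
    by (rule abs_summable_summable)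
qed

lemma bailey_chain_term_has_sum_funpow_step:
  assumes q: "norm q < 1" and \<beta>: "Bseq \<beta>" and \<beta>m: "Bseq ((bailey_step q ^^ m) \<beta>)"
  shows "(bailey_chain_term (Suc m) q \<beta> has_sum (\<Sum>N. q ^ N\<^sup>2 * (bailey_step q ^^ m) \<beta> N))
    (multi_indices (Suc m))"
proof -
  define T where "T = bailey_chain_term (Suc m) q \<beta>"
  define B where "B N = q ^ N\<^sup>2 * (bailey_step q ^^ m) \<beta> N" for N
  let ?fibres = "SIGMA N:UNIV. multi_indices_last (Suc m) N"
  have bij: "bij_betw snd ?fibres (multi_indices (Suc m))"
    by (rule bij_betw_snd_multi_indices_last)
  have fibre: "(T has_sum B N) (multi_indices_last (Suc m) N)" for N
    unfolding T_def B_def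
    using has_sum_finite[OF finite_multi_indices_last] sum_bailey_chain_term by metis
  have "(\<lambda>p. T (snd p)) summable_on ?fibres"
    using bailey_chain_term_summable_on[OF q \<beta>] summable_on_reindex_bij_betw[OF bij, of T]
    by (simp add: T_def)
  moreover have "(B has_sum (\<Sum>N. B N)) UNIV"
    unfolding B_def using summable_norm_power_square_mult_Bseq[OF q \<beta>m]
    by (blast intro: norm_summable_imp_has_sum summable_sums summable_norm_cancel)
  ultimately have "((\<lambda>p. T (snd p)) has_sum (\<Sum>N. B N)) ?fibres"
    using fibre by (intro has_sum_SigmaI) auto
  then show ?thesis
    using has_sum_reindex_bij_betw[OF bij, of T] by (simp add: T_def B_def)
qed

theorem bailey_chain_has_sum:
  assumes q: "norm q < 1" and "k \<ge> 1" and bp: "bailey_pair q \<alpha> \<beta>"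
    and \<alpha>: "summable (\<lambda>r. norm (\<alpha> r))"
  shows "(bailey_chain_term k q \<beta> has_sum 1 / qpoch_inf q q * (\<Sum>r. q ^ (k * r\<^sup>2) * \<alpha> r))
    (multi_indices k)"
proof -
  obtain m where k: "k = Suc m"
    using \<open>k \<ge> 1\<close> by (cases k) auto
  define \<alpha>m where "\<alpha>m r = q ^ (m * r\<^sup>2) * \<alpha> r" for r
  define \<beta>m where "\<beta>m = (bailey_step q ^^ m) \<beta>"
  have bpm: "bailey_pair q \<alpha>m \<beta>m"
    using bailey_pair_funpow_step[OF qpoch_nonzero bp] q by (simp add: \<alpha>m_def[abs_def] \<beta>m_def)
  have \<alpha>m: "summable (\<lambda>r. norm (\<alpha>m r))"
    unfolding \<alpha>m_def using q \<alpha> by (intro summable_norm_power_mult) auto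
  have "(bailey_chain_term k q \<beta> has_sum (\<Sum>N. q ^ N\<^sup>2 * \<beta>m N)) (multi_indices k)"
    using bailey_chain_term_has_sum_funpow_step[OF q bailey_pair_imp_Bseq[OF q bp \<alpha>]]
      bailey_pair_imp_Bseq[OF q bpm \<alpha>m] by (simp add: k \<beta>m_def)
  also have "(\<Sum>N. q ^ N\<^sup>2 * \<beta>m N) = 1 / qpoch_inf q q * (\<Sum>r. q ^ (k * r\<^sup>2) * \<alpha> r)"
    unfolding bailey_lemma_suminf[OF q bpm \<alpha>m] by (simp add: \<alpha>m_def k power_add mult.assoc)
  finally show ?thesis .
qed

subsection \<open>The Bailey pair of Chebyshev polynomials of the third kind\<close>

definition cheb_alpha :: "complex \<Rightarrow> complex \<Rightarrow> nat \<Rightarrow> complex" where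
  "cheb_alpha q x r = q ^ r\<^sup>2 * (cheb_V (int r) x + cheb_V (int r - 1) x)"

definition cheb_beta :: "complex \<Rightarrow> complex \<Rightarrow> nat \<Rightarrow> complex" where
  "cheb_beta q x n =
     (\<Prod>j=1..n. 1 + 2 * x * q ^ (2 * j - 1) + q ^ (4 * j - 2)) / qpoch (q\<^sup>2) (q\<^sup>2) (2 * n)"

lemma reciprocals_with_sum:
  fixes x :: complex
  obtains z w where "z * w = 1" "2 * x = z + w"
proof
  show "(x + csqrt (x\<^sup>2 - 1)) * (x - csqrt (x\<^sup>2 - 1)) = 1"
    by (simp add: algebra_simps flip: power2_eq_square)
qed simp

lemma cheb_V_nat_add_Suc:
  assumes "z * w = 1" and "2 * x = z + w"
  shows "cheb_V_nat (Suc n) x + cheb_V_nat n x = z ^ Suc n + w ^ Suc n"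
proof (induction n rule: induct_nat_012)
  case 0
  show ?case using assms by simp
next
  case 1
  show ?case using assms by (simp add: power2_eq_square) algebra
next
  case (ge2 n)
  have recurrence: "(z + w) * (z\<^sup>2 * a + w\<^sup>2 * b) - (z * a + w * b) = z ^ 3 * a + w ^ 3 * b" for a b
    using assms(1) by algebra
  have "cheb_V_nat (Suc (Suc (Suc n))) x + cheb_V_nat (Suc (Suc n)) x
      = (z + w) * (z ^ Suc (Suc n) + w ^ Suc (Suc n)) - (z ^ Suc n + w ^ Suc n)"
    unfolding ge2[symmetric] assms(2)[symmetric] by (simp add: algebra_simps)
  also have "\<dots> = z ^ Suc (Suc (Suc n)) + w ^ Suc (Suc (Suc n))"
    using recurrence[of "z ^ n" "w ^ n"] by (simp add: power2_eq_square power3_eq_cube mult.assoc)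
  finally show ?case .
qed

lemma cheb_alpha_eq:
  assumes "z * w = 1" and "2 * x = z + w"
  shows "cheb_alpha q x r = (if r = 0 then 1 else q ^ r\<^sup>2 * (z ^ r + w ^ r))"
proof (cases r)
  case (Suc n)
  then show ?thesis
    using cheb_V_nat_add_Suc[OF assms, of n]
    by (simp add: cheb_alpha_def cheb_V_def nat_add_distrib)
qed (simp add: cheb_alpha_def cheb_V_def)

lemma prod_quadratic_eq_reciprocals:
  fixes q x z w :: "'a :: comm_semiring_1"
  assumes "z * w = 1" and "2 * x = z + w"
  shows "(\<Prod>j=1..n. 1 + 2 * x * q ^ (2 * j - 1) + q ^ (4 * j - 2))
    = w ^ n * ((\<Prod>j<n. z + q ^ (2 * j + 1)) * (\<Prod>j<n. 1 + z * q ^ (2 * j + 1)))"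
proof -
  have factor: "1 + 2 * x * q ^ (2 * Suc j - 1) + q ^ (4 * Suc j - 2)
      = w * ((z + q ^ (2 * j + 1)) * (1 + z * q ^ (2 * j + 1)))" for j
  proof -
    have "w * ((z + a) * (1 + z * a)) = z * w + (z * w * z + w) * a + z * w * a\<^sup>2" for a
      by (simp add: power2_eq_square algebra_simps)
    then have "1 + 2 * x * a + a\<^sup>2 = w * ((z + a) * (1 + z * a))" for a
      by (simp add: assms)
    moreover have "q ^ (4 * Suc j - 2) = (q ^ (2 * j + 1))\<^sup>2"
      by (simp flip: power_mult power_Suc)
    ultimately show ?thesis
      by simp
  qed
  show ?thesis
    unfolding prod.atLeast1_atMost_eq[folded One_nat_def] factor by (simp add: prod.distrib)
qed

lemma sum_atMost_double_fold:
  fixes f :: "nat \<Rightarrow> 'a :: comm_monoid_add"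
  shows "(\<Sum>k\<le>2 * n. f k) = f n + (\<Sum>r=1..n. f (n + r) + f (n - r))"
proof (induction n arbitrary: f)
  case (Suc n)
  have "(\<Sum>k\<le>2 * Suc n. f k) = f 0 + f (2 * Suc n) + (\<Sum>k\<le>2 * n. f (Suc k))"
    using sum.atMost_Suc_shift[of f "Suc (2 * n)"] by (simp add: add_ac)
  also have "(\<Sum>k\<le>2 * n. f (Suc k)) = f (Suc n) + (\<Sum>r=1..n. f (Suc n + r) + f (Suc n - r))"
    unfolding Suc.IH by (simp add: Suc_diff_le)
  finally show ?case
    by (simp add: add_ac mult_2)
qed simp

lemma bailey_pair_cheb:
  assumes nz: "\<And>n. qpoch (q\<^sup>2) (q\<^sup>2) n \<noteq> 0"
  shows "bailey_pair (q\<^sup>2) (cheb_alpha q x) (cheb_beta q x)"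
  unfolding bailey_pair_def
proof
  fix n
  define Q where "Q = q\<^sup>2"
  obtain z w where zw: "z * w = 1" "2 * x = z + w"
    by (rule reciprocals_with_sum)
  define f where "f k = q ^ nat ((int k - int n)\<^sup>2) * (z ^ k * w ^ n)
    / (qpoch Q Q k * qpoch Q Q (2 * n - k))" for k
  have zw_pow: "z ^ r * w ^ r = 1" for r
    using zw(1) by (simp flip: power_mult_distrib)
  have centre: "f n = cheb_alpha q x 0 * bailey_kernel Q n 0"
    by (simp add: f_def bailey_kernel_def cheb_alpha_eq[OF zw] zw_pow mult_2)
  have paired: "f (n + r) + f (n - r) = cheb_alpha q x r * bailey_kernel Q n r"
    if "r \<in> {1..n}" for r
  proof -
    have "z ^ (n + r) * w ^ n = z ^ r"
      using zw_pow[of n] by (simp add: power_add)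
    moreover have "z ^ (n - r) * w ^ n = w ^ r"
      using that zw_pow[of "n - r"] power_add[of w "n - r" r] by (simp add: mult.assoc[symmetric])
    ultimately show ?thesis
      using that
      by (simp add: f_def bailey_kernel_def cheb_alpha_eq[OF zw] nat_power_eq
        distrib_left distrib_right add_divide_distrib mult_ac)
  qed
  have "cheb_beta q x n = (\<Sum>k\<le>2 * n. f k)"
    unfolding cheb_beta_def prod_quadratic_eq_reciprocals[OF zw] finite_triple_product
      mult_2[symmetric]
    using nz[of "2 * n"]
    by (simp add: qbinom_eq_qpoch[OF nz] sum_distrib_left sum_divide_distrib f_def Q_def field_simps)
  also have "\<dots> = f n + (\<Sum>r=1..n. f (n + r) + f (n - r))"
    by (rule sum_atMost_double_fold)
  also have "\<dots> = cheb_alpha q x 0 * bailey_kernel Q n 0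
      + (\<Sum>r=1..n. cheb_alpha q x r * bailey_kernel Q n r)"
    using centre paired by simp
  finally show "cheb_beta q x n = (\<Sum>r\<le>n. cheb_alpha q x r * bailey_kernel (q\<^sup>2) n r)"
    by (simp add: Q_def atMost_atLeast0 sum.atLeast_Suc_atMost)
qed

lemma summable_norm_theta:
  fixes q z :: "'a :: real_normed_field"
  assumes q: "norm q < 1"
  shows "summable (\<lambda>r. norm (q ^ r\<^sup>2 * z ^ r))"
proof -
  have "(\<lambda>r. norm (q ^ r * z)) \<longlonglongrightarrow> 0"
    using q by (intro tendsto_norm_zero tendsto_mult_left_zero LIMSEQ_power_zero)
  then have "\<forall>\<^sub>F r in sequentially. norm (q ^ r * z) < 1 / 2"
    by (rule order_tendstoD) simp
  then have "\<forall>\<^sub>F r in sequentially. norm (norm (q ^ r\<^sup>2 * z ^ r)) \<le> (1 / 2) ^ r"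
  proof eventually_elim
    case (elim r)
    have "norm (q ^ r\<^sup>2 * z ^ r) = norm (q ^ r * z) ^ r"
      by (simp add: power2_eq_square power_mult power_mult_distrib flip: norm_power)
    then show ?case
      using elim by (simp add: power_mono)
  qed
  then show ?thesis
    by (rule summable_comparison_test_ev) (simp add: summable_geometric)
qed

lemma summable_norm_cheb_alpha:
  assumes "norm q < 1"
  shows "summable (\<lambda>r. norm (cheb_alpha q x r))"
proof -
  obtain z w where zw: "z * w = 1" "2 * x = z + w"
    by (rule reciprocals_with_sum)
  show ?thesis
  proof (rule summable_comparison_test'[where N = 0])
    show "summable (\<lambda>r. norm (q ^ r\<^sup>2 * z ^ r) + norm (q ^ r\<^sup>2 * w ^ r))"
      by (intro summable_add summable_norm_theta assms)
    show "norm (norm (cheb_alpha q x r)) \<le> norm (q ^ r\<^sup>2 * z ^ r) + norm (q ^ r\<^sup>2 * w ^ r)" for r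
      using norm_triangle_ineq[of "q ^ r\<^sup>2 * z ^ r" "q ^ r\<^sup>2 * w ^ r"]
      by (simp add: cheb_alpha_eq[OF zw] distrib_left)
  qed
qed

lemma multisum_term_eq: "multisum_term k q x = bailey_chain_term k (q\<^sup>2) (cheb_beta q x)"
  by (simp add: fun_eq_iff multisum_term_def bailey_chain_term_def cheb_beta_def field_simps
    flip: power_mult)

theorem theorem4p5:
  fixes q x :: complex and k :: nat
  assumes "norm q < 1" and "k \<ge> 1"
  shows "summable (\<lambda>n. q ^ ((2 * k + 1) * n\<^sup>2) * (cheb_V (int n) x + cheb_V (int n - 1) x)) \<and>
    multisum_term k q x summable_on multi_indices k \<and>
    1 / qpoch_inf (q\<^sup>2) (q\<^sup>2) *
      (\<Sum>n. q ^ ((2 * k + 1) * n\<^sup>2) * (cheb_V (int n) x + cheb_V (int n - 1) x))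
    = (\<Sum>\<^sub>\<infinity>n\<in>multi_indices k. multisum_term k q x n)"
proof -
  have Q: "norm (q\<^sup>2) < 1"
    using assms by (simp add: norm_power power_less_one_iff)
  have \<alpha>: "summable (\<lambda>r. norm (cheb_alpha q x r))"
    by (rule summable_norm_cheb_alpha[OF assms(1)])
  have term_eq: "q ^ ((2 * k + 1) * n\<^sup>2) * (cheb_V (int n) x + cheb_V (int n - 1) x)
      = (q\<^sup>2) ^ (k * n\<^sup>2) * cheb_alpha q x n" for n
    by (simp add: cheb_alpha_def power_add mult.assoc distrib_right flip: power_mult)
  have "summable (\<lambda>n. (q\<^sup>2) ^ (k * n\<^sup>2) * cheb_alpha q x n)"
    using Q by (intro summable_norm_cancel[OF summable_norm_power_mult] \<alpha>) simp
  moreover have "(multisum_term k q x has_sum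
      1 / qpoch_inf (q\<^sup>2) (q\<^sup>2) * (\<Sum>n. (q\<^sup>2) ^ (k * n\<^sup>2) * cheb_alpha q x n)) (multi_indices k)"
    unfolding multisum_term_eq using Q
    by (intro bailey_chain_has_sum bailey_pair_cheb qpoch_nonzero assms(2) \<alpha>) auto
  ultimately show ?thesis
    unfolding term_eq by (simp add: has_sum_iff)
qed

end
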